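(* For every Tychonoff space $X$, $w(X)\leq |C(X)|\leq nw(X)^{Nag(X)}$.
   Context: All spaces are Tychonoff; cardinal invariants ($w$ = weight, $nw$ = network weight, etc.) take infinite values. $C(X)$ denotes the set of continuous real-valued functions on $X$. For a Tychonoff space $X$ with Stone–Čech compactification $\beta X$, a family $\mathcal F$ of closed subsets of $\beta X$ separates points of $X$ from $\beta X\setminus X$ if for every $x\in X$ and $y\in\beta X\setminus X$ there is $F\in\mathcal F$ with $x\in F$, $y\notin F$. The Nagami number $Nag(X)$ is the minimal cardinality of such a family $\mathcal F$ (taken to be at least $\omega$). *)

theory Defs
  imports "HOL-Analysis.Analysis"
begin

definition tychonoff_space :: "'a topology \<Rightarrow> bool" where
  "tychonoff_space X \<longleftrightarrow> completely_regular_space X \<and> t1_space X"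

definition Cfun :: "'a topology \<Rightarrow> ('a \<Rightarrow> real) set" where
  "Cfun X = {f. continuous_map X euclideanreal f \<and> f \<in> extensional (topspace X)}"

text \<open>A set chosen of minimal cardinality among those satisfying P
  (exists whenever P is satisfiable, since cardinals are well-ordered).\<close>
definition min_card_set :: "('b set \<Rightarrow> bool) \<Rightarrow> 'b set" where
  "min_card_set P = (SOME B. P B \<and> (\<forall>B'. P B' \<longrightarrow> (card_of B, card_of B') \<in> ordLeq))"

text \<open>Infinite-valued cardinal invariant: max(omega, minimal cardinality),
  realised as the cardinal sum with omega (natLeq).\<close>
definition inf_min_card :: "('b set \<Rightarrow> bool) \<Rightarrow> ('b + nat) rel" where
  "inf_min_card P = BNF_Cardinal_Arithmetic.csum (card_of (min_card_set P)) natLeq"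

definition is_base :: "'a topology \<Rightarrow> 'a set set \<Rightarrow> bool" where
  "is_base X \<B> \<longleftrightarrow> (\<forall>B\<in>\<B>. openin X B) \<and>
     (\<forall>U x. openin X U \<and> x \<in> U \<longrightarrow> (\<exists>B\<in>\<B>. x \<in> B \<and> B \<subseteq> U))"

definition is_network :: "'a topology \<Rightarrow> 'a set set \<Rightarrow> bool" where
  "is_network X \<N> \<longleftrightarrow> (\<forall>N\<in>\<N>. N \<subseteq> topspace X) \<and>
     (\<forall>U x. openin X U \<and> x \<in> U \<longrightarrow> (\<exists>N\<in>\<N>. x \<in> N \<and> N \<subseteq> U))"

definition weight :: "'a topology \<Rightarrow> ('a set + nat) rel" where
  "weight X = inf_min_card (is_base X)"

definition netweight :: "'a topology \<Rightarrow> ('a set + nat) rel" where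
  "netweight X = inf_min_card (is_network X)"

definition sc_index :: "'a topology \<Rightarrow> ('a \<Rightarrow> real) set" where
  "sc_index X = {f. continuous_map X (top_of_set {0..1}) f \<and> f \<in> extensional (topspace X)}"

definition sc_cube :: "'a topology \<Rightarrow> (('a \<Rightarrow> real) \<Rightarrow> real) topology" where
  "sc_cube X = product_topology (\<lambda>_. top_of_set {0..1::real}) (sc_index X)"

definition sc_embed :: "'a topology \<Rightarrow> 'a \<Rightarrow> (('a \<Rightarrow> real) \<Rightarrow> real)" where
  "sc_embed X x = restrict (\<lambda>f. f x) (sc_index X)"

definition stone_cech :: "'a topology \<Rightarrow> (('a \<Rightarrow> real) \<Rightarrow> real) topology" where
  "stone_cech X = subtopology (sc_cube X) (sc_cube X closure_of (sc_embed X ` topspace X))"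

definition nagami_family :: "'a topology \<Rightarrow> (('a \<Rightarrow> real) \<Rightarrow> real) set set \<Rightarrow> bool" where
  "nagami_family X \<F> \<longleftrightarrow> (\<forall>F\<in>\<F>. closedin (stone_cech X) F) \<and>
     (\<forall>x\<in>topspace X. \<forall>y\<in>topspace (stone_cech X) - sc_embed X ` topspace X.
        \<exists>F\<in>\<F>. sc_embed X x \<in> F \<and> y \<notin> F)"

definition nagami :: "'a topology \<Rightarrow> ((('a \<Rightarrow> real) \<Rightarrow> real) set + nat) rel" where
  "nagami X = inf_min_card (nagami_family X)"

end

theory Submission
  imports Defs "HOL-Algebra.Free_Abelian_Groups"
begin

text \<open>
  The cozero sets of continuous functions form a base, which gives the first inequality.
  For the second, fix a network \<open>\<N>\<close> and a Nagami family \<open>\<F>\<close>. For every \<open>x\<close> the intersection of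
  the members of \<open>\<F>\<close> containing \<open>x\<close> is a compact subset \<open>K\<close> of \<open>X\<close>, and every neighbourhood
  of \<open>K\<close> contains the trace of a finite intersection of members of \<open>\<F>\<close>. Choosing disjoint open
  neighbourhoods for pairs of members of \<open>\<N>\<close> yields a family \<open>P\<close> of disjoint open pairs that
  separates points, so disjoint compact sets are separated by finite lattice combinations of
  pairs in \<open>P\<close>. A continuous \<open>f\<close> is then determined by the function that assigns to rationals
  \<open>p < q\<close> and to a finite \<open>s \<subseteq> \<F>\<close> a combination separating \<open>{f \<le> p}\<close> from \<open>{f \<ge> q}\<close> inside the
  trace of \<open>\<Inter>s\<close>, if there is one.
\<close>

unbundle cardinal_syntax

section \<open>Cardinalities\<close>

text \<open>\<open>SOME\<close> is informative only once some set satisfies \<open>P\<close>. A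
  minimum then exists because cardinals are well-ordered.\<close>

lemma min_card_set_minimal:
  assumes "P A"
  shows "P (min_card_set P)" and "P B \<Longrightarrow> |min_card_set P| \<le>o |B|"
proof -
  have "\<exists>r\<in>card_of ` Collect P. \<forall>r'\<in>card_of ` Collect P. r \<le>o r'"
    using assms by (intro exists_minim_Card_order) (auto simp: card_of_Card_order)
  then have "\<exists>B. P B \<and> (\<forall>B'. P B' \<longrightarrow> |B| \<le>o |B'| )"
    by auto
  from someI_ex[OF this]
  show "P (min_card_set P)" "P B \<Longrightarrow> |min_card_set P| \<le>o |B|"
    unfolding min_card_set_def by blast+
qed

text \<open>This writes the invariant as the cardinality of a concrete infinite set, so that
  cardinal powers unfold to \<open>Func\<close> between sets.\<close>

lemma inf_min_card_eq: "inf_min_card P = |min_card_set P <+> (UNIV :: nat set)|"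
  by (simp add: inf_min_card_def csum_def Field_card_of Field_natLeq)

text \<open>An injection of \<open>A\<close> into \<open>B\<close> acts on finite subsets, and the
  infinite set \<open>B\<close> is equipotent with \<open>Fpow B\<close>.\<close>

lemma card_of_Fpow_ordLeq:
  assumes "infinite B" "|A| \<le>o |B|"
  shows "|Fpow A| \<le>o |B|"
proof -
  obtain g where g: "inj_on g A" "g ` A \<subseteq> B"
    using assms(2) card_of_ordLeq[of A B] by blast
  have "inj_on (image g) (Fpow A)"
    using g(1) by (rule inj_on_image_Fpow)
  moreover have "image g ` Fpow A \<subseteq> Fpow B"
    using g(2) by (auto simp: Fpow_def)
  ultimately have "|Fpow A| \<le>o |Fpow B|"
    using card_of_ordLeq by blast
  moreover have "|Fpow B| =o |B|"
    using eqpoll_Fpow[OF assms(1)] by (simp add: eqpoll_iff_card_of_ordIso)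
  ultimately show ?thesis
    by (rule ordLeq_ordIso_trans)
qed

lemma card_of_option_ordLeq:
  fixes A :: "'a set"
  assumes "infinite B" "|A| \<le>o |B|"
  shows "|insert None (Some ` A)| \<le>o |B|"
proof -
  have "|{None} \<union> Some ` A| \<le>o |B|"
  proof (rule card_of_Un_ordLeq_infinite_Field)
    show "|{None :: 'a option}| \<le>o |B|"
      using assms(1) by (intro card_of_singl_ordLeq) auto
    show "|Some ` A| \<le>o |B|"
      using card_of_image assms(2) by (rule ordLeq_transitive)
  qed (use assms(1) in \<open>auto simp: Field_card_of card_of_Card_order\<close>)
  then show ?thesis
    by simp
qed

lemma countable_ordLeq_infinite:
  assumes "countable A" "infinite B"
  shows "|A| \<le>o |B|"
proof -
  have "|A| \<le>o |UNIV :: nat set|"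
    using assms(1) unfolding countable_def by (metis card_of_ordLeq subset_UNIV)
  moreover have "|UNIV :: nat set| \<le>o |B|"
    using assms(2) infinite_iff_card_of_nat by blast
  ultimately show ?thesis
    by (rule ordLeq_transitive)
qed

text \<open>\<open>D\<close> must be nonempty: if \<open>D\<close>, \<open>V\<close> and
  \<open>B\<close> are empty and \<open>L\<close> is not, the left side has one function and the
  right side none.\<close>

lemma card_of_Func_mono:
  assumes "|D| \<le>o |L|" "|V| \<le>o |B|" "D \<noteq> {}"
  shows "|Func D V| \<le>o |Func L B|"
proof -
  have "|V| ^c |D| \<le>o |B| ^c |L|"
    by (rule cexp_mono'[OF assms(2,1)]) (use assms(3) in \<open>simp add: Field_card_of\<close>)
  then show ?thesis
    unfolding cexp_def Field_card_of .
qed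

section \<open>Compactness\<close>

lemma compactin_indexed_subcover:
  assumes "compactin X A" "\<And>i. i \<in> I \<Longrightarrow> openin X (U i)" "A \<subseteq> (\<Union>i\<in>I. U i)"
  shows "\<exists>J. finite J \<and> J \<subseteq> I \<and> A \<subseteq> (\<Union>i\<in>J. U i)"
proof -
  have "\<exists>\<V>. finite \<V> \<and> \<V> \<subseteq> U ` I \<and> A \<subseteq> \<Union>\<V>"
    by (rule compactinD[OF assms(1)]) (use assms(2,3) in auto)
  then obtain \<V> where "finite \<V>" "\<V> \<subseteq> U ` I" "A \<subseteq> \<Union>\<V>"
    by blast
  then show ?thesis
    by (metis finite_subset_image)
qed

lemma compact_space_Inter_subset_open:
  assumes Y: "compact_space Y" and \<G>: "\<And>F. F \<in> \<G> \<Longrightarrow> closedin Y F"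
    and V: "openin Y V" "topspace Y \<inter> \<Inter>\<G> \<subseteq> V"
  shows "\<exists>s. finite s \<and> s \<subseteq> \<G> \<and> topspace Y \<inter> \<Inter>s \<subseteq> V"
proof -
  \<comment> \<open>A finite subcover by these sets names the finitely many \<open>F\<close> wanted.
    The extra index \<open>topspace Y\<close> contributes \<open>V\<close> alone, so the cover also
    works for empty \<open>\<G>\<close>.\<close>
  let ?U = "\<lambda>F. V \<union> (topspace Y - F)"
  have "compactin Y (topspace Y)"
    using Y by (simp add: compact_space_def)
  moreover have "openin Y (?U F)" if "F \<in> insert (topspace Y) \<G>" for F
    using that V(1) \<G> by (intro openin_Un) auto
  moreover have "topspace Y \<subseteq> (\<Union>F\<in>insert (topspace Y) \<G>. ?U F)"
    using V(2) by auto
  ultimately have "\<exists>t. finite t \<and> t \<subseteq> insert (topspace Y) \<G> \<and> topspace Y \<subseteq> (\<Union>F\<in>t. ?U F)"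
    by (rule compactin_indexed_subcover)
  then obtain t where t: "finite t" "t \<subseteq> insert (topspace Y) \<G>" "topspace Y \<subseteq> (\<Union>F\<in>t. ?U F)"
    by blast
  have "finite (t \<inter> \<G>)" "t \<inter> \<G> \<subseteq> \<G>"
    using t(1) by auto
  moreover have "topspace Y \<inter> \<Inter>(t \<inter> \<G>) \<subseteq> V"
    using t(2,3) by blast
  ultimately show ?thesis
    by blast
qed

section \<open>Lattice combinations of disjoint open pairs\<close>

definition lower_comb :: "('a set \<times> 'a set) set set \<Rightarrow> 'a set" where
  "lower_comb E = (\<Union>e\<in>E. \<Inter>c\<in>e. fst c)"

text \<open>The dual of \<open>lower_comb\<close>, applied to the partner sets, so that disjointness
  of the pairs passes to the combinations.\<close>

definition upper_comb :: "('a set \<times> 'a set) set set \<Rightarrow> 'a set" where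
  "upper_comb E = (\<Inter>e\<in>E. \<Union>c\<in>e. snd c)"

text \<open>A common point would lie in all first components of one \<open>e\<close> in
  \<open>E\<close>, and also in a second component of some pair of the same
  \<open>e\<close>.\<close>

lemma disjnt_lower_upper_comb:
  assumes "E \<subseteq> Pow P" "\<And>c. c \<in> P \<Longrightarrow> disjnt (fst c) (snd c)"
  shows "disjnt (lower_comb E) (upper_comb E)"
proof -
  have False if lower: "x \<in> lower_comb E" and upper: "x \<in> upper_comb E" for x
  proof -
    obtain e where e: "e \<in> E" "\<And>c. c \<in> e \<Longrightarrow> x \<in> fst c"
      using lower unfolding lower_comb_def by blast
    then obtain c where c: "c \<in> e" "x \<in> snd c"
      using upper unfolding upper_comb_def by blast
    then have "c \<in> P"
      using e(1) assms(1) by blast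
    then show False
      using assms(2) e(2)[OF c(1)] c(2) unfolding disjnt_iff by blast
  qed
  then show ?thesis
    unfolding disjnt_iff by blast
qed

text \<open>An empty \<open>e\<close> has the whole type as its intersection, hence the cut with
  \<open>topspace X\<close>. In the dual lemma an empty \<open>E\<close> has this effect.\<close>

lemma openin_Int_lower_comb:
  assumes "E \<in> Fpow (Fpow P)" "\<And>c. c \<in> P \<Longrightarrow> openin X (fst c)"
  shows "openin X (topspace X \<inter> lower_comb E)"
proof -
  have "openin X (topspace X \<inter> (\<Inter>c\<in>e. fst c))" if "e \<in> E" for e
    using that assms by (intro openin_Int_Inter) (auto simp: Fpow_def)
  then have "openin X (\<Union>e\<in>E. topspace X \<inter> (\<Inter>c\<in>e. fst c))"
    by blast
  then show ?thesis
    unfolding lower_comb_def Int_UN_distrib .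
qed

lemma openin_Int_upper_comb:
  assumes "E \<in> Fpow (Fpow P)" "\<And>c. c \<in> P \<Longrightarrow> openin X (snd c)"
  shows "openin X (topspace X \<inter> upper_comb E)"
proof -
  have "openin X (\<Union>c\<in>e. snd c)" if "e \<in> E" for e
    using that assms by (intro openin_Union) (auto simp: Fpow_def)
  then show ?thesis
    unfolding upper_comb_def using assms(1)
    by (intro openin_Int_Inter) (auto simp: Fpow_def)
qed

text \<open>Compactness is used twice, as in separating disjoint compact sets of a Hausdorff space:
  \<open>B\<close> is covered for each fixed \<open>a\<close>, then \<open>A\<close> is covered by
  the resulting finite meets.\<close>

lemma compact_separation:
  assumes A: "compactin X A" and B: "compactin X B"
    and P: "\<And>c. c \<in> P \<Longrightarrow> openin X (fst c) \<and> openin X (snd c)"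
    and sep: "\<And>a b. a \<in> A \<Longrightarrow> b \<in> B \<Longrightarrow> \<exists>c\<in>P. a \<in> fst c \<and> b \<in> snd c"
  shows "\<exists>E\<in>Fpow (Fpow P). A \<subseteq> lower_comb E \<and> B \<subseteq> upper_comb E"
proof -
  have "\<exists>e\<in>Fpow P. a \<in> (\<Inter>c\<in>e. fst c) \<and> B \<subseteq> (\<Union>c\<in>e. snd c)" if "a \<in> A" for a
  proof -
    have "B \<subseteq> (\<Union>c\<in>{c\<in>P. a \<in> fst c}. snd c)"
      using sep[OF that] by fastforce
    then have "\<exists>e. finite e \<and> e \<subseteq> {c\<in>P. a \<in> fst c} \<and> B \<subseteq> (\<Union>c\<in>e. snd c)"
      by (rule compactin_indexed_subcover[OF B, rotated]) (use P in auto)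
    then obtain e where "finite e" "e \<subseteq> {c\<in>P. a \<in> fst c}" "B \<subseteq> (\<Union>c\<in>e. snd c)"
      by blast
    then show ?thesis
      by (intro bexI[of _ e]) (auto simp: Fpow_def)
  qed
  then obtain e where e: "\<And>a. a \<in> A \<Longrightarrow> e a \<in> Fpow P"
      "\<And>a. a \<in> A \<Longrightarrow> a \<in> (\<Inter>c\<in>e a. fst c)" "\<And>a. a \<in> A \<Longrightarrow> B \<subseteq> (\<Union>c\<in>e a. snd c)"
    by metis
  let ?G = "\<lambda>a. topspace X \<inter> (\<Inter>c\<in>e a. fst c)"
  have "A \<subseteq> topspace X"
    using A by (rule compactin_subset_topspace)
  then have "A \<subseteq> (\<Union>a\<in>A. ?G a)"
    using e(2) by blast
  then have "\<exists>T. finite T \<and> T \<subseteq> A \<and> A \<subseteq> (\<Union>a\<in>T. ?G a)"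
  proof (rule compactin_indexed_subcover[OF A, rotated])
    show "openin X (?G a)" if "a \<in> A" for a
      using e(1)[OF that] P by (intro openin_Int_Inter) (auto simp: Fpow_def)
  qed
  then obtain T where T: "finite T" "T \<subseteq> A" "A \<subseteq> (\<Union>a\<in>T. ?G a)"
    by blast
  show ?thesis
  proof (intro bexI conjI)
    show "e ` T \<in> Fpow (Fpow P)"
      using T e(1) by (auto simp: Fpow_def)
    show "A \<subseteq> lower_comb (e ` T)"
      using T(3) unfolding lower_comb_def by blast
    show "B \<subseteq> upper_comb (e ` T)"
      using T(2) e(3) unfolding upper_comb_def by blast
  qed
qed

section \<open>The Stone--Cech compactification\<close>

lemma tychonoff_imp_Hausdorff: "tychonoff_space X \<Longrightarrow> Hausdorff_space X"
  unfolding tychonoff_space_def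
  by (simp add: completely_regular_imp_regular_space regular_t1_imp_Hausdorff_space)

lemma compact_space_stone_cech: "compact_space (stone_cech X)"
proof -
  have "compact_space (sc_cube X)"
    unfolding sc_cube_def
    by (intro compact_space_product_topology[THEN iffD2]) (auto simp: compact_space_subtopology)
  then show ?thesis
    unfolding stone_cech_def
    by (intro compact_space_subtopology closedin_compact_space) auto
qed

lemma Hausdorff_space_stone_cech: "Hausdorff_space (stone_cech X)"
  unfolding stone_cech_def sc_cube_def
  by (intro Hausdorff_space_subtopology)
     (auto simp: Hausdorff_space_product_topology Hausdorff_space_subtopology)

lemma embedding_map_image_subset:
  assumes "embedding_map X Y f"
  shows "f ` topspace X \<subseteq> topspace Y"
  using assms unfolding embedding_map_def
  by (meson continuous_map_in_subtopology continuous_map_image_subset_topspace homeomorphic_imp_continuous_map)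

lemma sc_embed_embedding:
  assumes "tychonoff_space X"
  shows "embedding_map X (stone_cech X) (sc_embed X)"
proof -
  \<comment> \<open>The embedding theorem applied below indexes its cube by bounded continuous
    functions with values in the unit interval. Boundedness is automatic, so this is
    \<open>sc_index X\<close>.\<close>
  have eq: "mspace (submetric (cfunspace X euclidean_metric) {f. f \<in> topspace X \<rightarrow> {0..1}}) = sc_index X"
  proof -
    have "Metric_space.mbounded UNIV dist (f ` topspace X)" if "f \<in> topspace X \<rightarrow> {0..1::real}" for f
    proof -
      have "bounded (f ` topspace X)"
        using that by (intro bounded_subset[OF bounded_closed_interval[of 0 1]]) auto
      then show ?thesis
        by simp
    qed
    then show ?thesis
      by (auto simp: sc_index_def continuous_map_in_subtopology mtopology_of_euclidean)
  qed
  have "embedding_map X (sc_cube X) (sc_embed X)"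
    using completely_regular_space_cube_embedding_explicit[of X] assms tychonoff_imp_Hausdorff[OF assms]
    unfolding eq sc_cube_def sc_embed_def tychonoff_space_def by simp
  moreover from this have "sc_embed X ` topspace X \<subseteq> topspace (sc_cube X)"
    by (rule embedding_map_image_subset)
  ultimately show ?thesis
    unfolding stone_cech_def embedding_map_in_subtopology by (simp add: closure_of_subset)
qed

text \<open>Points of the Hausdorff compactification are closed, so the singleton of the image of
  \<open>x\<close> separates. This makes the minimum in \<open>nagami\<close> meaningful.\<close>

lemma nagami_family_exists:
  assumes "tychonoff_space X"
  shows "nagami_family X {F. closedin (stone_cech X) F}"
proof -
  let ?e = "sc_embed X" and ?Y = "stone_cech X"
  have "?e ` topspace X \<subseteq> topspace ?Y"
    using sc_embed_embedding[OF assms] by (rule embedding_map_image_subset)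
  then have "closedin ?Y {?e x}" if "x \<in> topspace X" for x
    using that closedin_Hausdorff_sing_eq[OF Hausdorff_space_stone_cech] by blast
  then show ?thesis
    unfolding nagami_family_def by blast
qed

lemma nagami_family_compact:
  assumes X: "tychonoff_space X" and \<F>: "nagami_family X \<F>" and x: "x \<in> topspace X"
  shows "\<exists>K. compactin X K \<and> (\<forall>U. openin X U \<and> K \<subseteq> U \<longrightarrow>
      (\<exists>s\<in>Fpow \<F>. sc_embed X x \<in> \<Inter>s \<and> {z\<in>topspace X. sc_embed X z \<in> \<Inter>s} \<subseteq> U))"
proof -
  let ?e = "sc_embed X" and ?Y = "stone_cech X"
  let ?Z = "subtopology ?Y (?e ` topspace X)"
  define \<G> where "\<G> = {F\<in>\<F>. ?e x \<in> F}"
  \<comment> \<open>\<open>\<G>\<close> may be empty, and its bare intersection is then the whole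
    type. The cut keeps \<open>H\<close> inside the compactification.\<close>
  define H where "H = topspace ?Y \<inter> \<Inter>\<G>"
  define K where "K = {z\<in>topspace X. ?e z \<in> H}"
  have hom: "homeomorphic_map X ?Z ?e"
    using sc_embed_embedding[OF X] unfolding embedding_map_def .
  have eX: "?e ` topspace X \<subseteq> topspace ?Y"
    using sc_embed_embedding[OF X] by (rule embedding_map_image_subset)
  have \<G>_closed: "closedin ?Y F" if "F \<in> \<G>" for F
    using that \<F> unfolding \<G>_def nagami_family_def by blast
  \<comment> \<open>A point of \<open>H\<close> outside the copy of \<open>X\<close> would be
    excluded by a member of \<open>\<F>\<close> containing the image of \<open>x\<close>, that is,
    by a member of \<open>\<G>\<close>.\<close>
  have H_sub: "H \<subseteq> ?e ` topspace X"
  proof (rule ccontr)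
    assume "\<not> H \<subseteq> ?e ` topspace X"
    then obtain y where y: "y \<in> H" "y \<notin> ?e ` topspace X"
      by blast
    then obtain F where "F \<in> \<F>" "?e x \<in> F" "y \<notin> F"
      using \<F> x unfolding nagami_family_def H_def by blast
    with y show False
      unfolding H_def \<G>_def by blast
  qed
  have "closedin ?Y H"
  proof -
    have "H = \<Inter>(insert (topspace ?Y) \<G>)"
      unfolding H_def by simp
    then show ?thesis
      using \<G>_closed by (metis closedin_Inter closedin_topspace insert_iff insert_not_empty)
  qed
  then have "compactin ?Y H"
    using compact_space_stone_cech closedin_compact_space by blast
  moreover have "?e ` K = H"
    using H_sub unfolding K_def by blast
  ultimately have "compactin ?Z (?e ` K)"
    using H_sub by (simp add: compactin_subtopology)
  then have K: "compactin X K"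
    using homeomorphic_map_compactness[OF hom, of K] unfolding K_def by auto
  moreover have "\<exists>s\<in>Fpow \<F>. ?e x \<in> \<Inter>s \<and> {z\<in>topspace X. ?e z \<in> \<Inter>s} \<subseteq> U"
    if U: "openin X U" "K \<subseteq> U" for U
  proof -
    have UX: "U \<subseteq> topspace X"
      using U(1) by (rule openin_subset)
    have "openin ?Z (?e ` U)"
      using homeomorphic_map_openness[OF hom UX] U(1) by blast
    then obtain V where V: "openin ?Y V" "?e ` U = V \<inter> ?e ` topspace X"
      unfolding openin_subtopology by blast
    have "H \<subseteq> V"
      using H_sub U(2) V(2) unfolding K_def by blast
    then have "\<exists>s. finite s \<and> s \<subseteq> \<G> \<and> topspace ?Y \<inter> \<Inter>s \<subseteq> V"
      unfolding H_def by (rule compact_space_Inter_subset_open[OF compact_space_stone_cech \<G>_closed V(1), rotated -1])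
    then obtain s where s: "finite s" "s \<subseteq> \<G>" "topspace ?Y \<inter> \<Inter>s \<subseteq> V"
      by blast
    \<comment> \<open>\<open>V\<close> cuts out the image of \<open>U\<close> on the copy of
      \<open>X\<close>, and injectivity of the embedding returns from images to points.\<close>
    have "z \<in> U" if z: "z \<in> topspace X" "?e z \<in> \<Inter>s" for z
    proof -
      have "?e z \<in> ?e ` U"
        using z s(3) V(2) eX by blast
      moreover have "inj_on ?e (topspace X)"
        using hom homeomorphic_imp_injective_map by blast
      ultimately show ?thesis
        using z(1) UX by (meson inj_on_image_mem_iff)
    qed
    then show ?thesis
      using s(1,2) unfolding \<G>_def by (intro bexI[of _ s]) (auto simp: Fpow_def)
  qed
  ultimately show ?thesis
    by (intro exI[of _ K] conjI allI impI) simp_all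
qed

section \<open>Bounds for the number of continuous functions\<close>

text \<open>Constants are told apart by their value at a point. The empty space has only one
  extensional function.\<close>

lemma infinite_Cfun:
  assumes "topspace X \<noteq> {}"
  shows "infinite (Cfun X)"
proof -
  obtain x where x: "x \<in> topspace X"
    using assms by blast
  have "inj_on (\<lambda>c::real. \<lambda>y\<in>topspace X. c) UNIV"
    using x by (intro inj_onI) (metis restrict_apply')
  moreover have "range (\<lambda>c::real. \<lambda>y\<in>topspace X. c) \<subseteq> Cfun X"
    by (auto simp: Cfun_def continuous_map_eq[OF continuous_map_const[THEN iffD2]])
  ultimately show ?thesis
    by (meson infinite_super range_inj_infinite infinite_UNIV_char_0 finite_imageD)
qed

lemma restrict_in_Cfun:
  assumes "continuous_map X euclideanreal f"
  shows "restrict f (topspace X) \<in> Cfun X"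
  using continuous_map_eq[OF assms, of "restrict f (topspace X)"] by (simp add: Cfun_def)

lemma is_base_cozero:
  assumes "completely_regular_space X"
  shows "is_base X ((\<lambda>f. {x\<in>topspace X. f x \<noteq> 0}) ` Cfun X)"
  unfolding is_base_def
proof (intro conjI ballI allI impI)
  fix B assume "B \<in> (\<lambda>f. {x\<in>topspace X. f x \<noteq> 0}) ` Cfun X"
  then obtain f where "continuous_map X euclideanreal f" "B = {x\<in>topspace X. f x \<in> - {0}}"
    by (auto simp: Cfun_def)
  then show "openin X B"
    using openin_continuous_map_preimage[of X euclideanreal f "- {0}"] by (simp add: open_Compl)
next
  fix U x assume U: "openin X U \<and> x \<in> U"
  then obtain f where f: "continuous_map X euclideanreal f" "f x = 0" "f ` (topspace X - U) \<subseteq> {1}"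
    using assms unfolding completely_regular_space_alt' by metis
  \<comment> \<open>\<open>f\<close> is 0 at \<open>x\<close> and 1 off \<open>U\<close>. Taking
    \<open>1 - f\<close> exchanges these values, so the cozero set contains \<open>x\<close> and
    stays in \<open>U\<close>.\<close>
  define g where "g = restrict (\<lambda>y. 1 - f y) (topspace X)"
  have "g \<in> Cfun X"
    unfolding g_def using f(1) by (intro restrict_in_Cfun continuous_intros) auto
  moreover have "x \<in> topspace X"
    using U openin_subset by blast
  moreover have "{y\<in>topspace X. g y \<noteq> 0} \<subseteq> U"
    using f(3) unfolding g_def by fastforce
  moreover have "x \<in> {y\<in>topspace X. g y \<noteq> 0}"
    using f(2) \<open>x \<in> topspace X\<close> by (simp add: g_def)
  ultimately show "\<exists>B\<in>(\<lambda>f. {x\<in>topspace X. f x \<noteq> 0}) ` Cfun X. x \<in> B \<and> B \<subseteq> U"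
    by blast
qed

lemma weight_ordLeq_Cfun:
  assumes "completely_regular_space X" "topspace X \<noteq> {}"
  shows "weight X \<le>o |Cfun X|"
proof -
  have "|min_card_set (is_base X)| \<le>o |Cfun X|"
    using min_card_set_minimal(2)[where P = "is_base X", OF is_base_cozero is_base_cozero, OF assms(1,1)]
      card_of_image by (rule ordLeq_transitive)
  moreover have "|UNIV :: nat set| \<le>o |Cfun X|"
    using infinite_Cfun[OF assms(2)] infinite_iff_card_of_nat by blast
  ultimately show ?thesis
    unfolding weight_def inf_min_card_eq using infinite_Cfun[OF assms(2)]
    by (intro card_of_Plus_ordLeq_infinite_Field) (auto simp: Field_card_of card_of_Card_order)
qed

section \<open>Second inequality: coding continuous functions\<close>

lemma network_separating_pairs:
  assumes X: "Hausdorff_space X" and \<N>: "is_network X \<N>"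
  shows "\<exists>P. |P| \<le>o |\<N> \<times> \<N>| \<and>
    (\<forall>c\<in>P. openin X (fst c) \<and> openin X (snd c) \<and> disjnt (fst c) (snd c)) \<and>
    (\<forall>x\<in>topspace X. \<forall>y\<in>topspace X. x \<noteq> y \<longrightarrow> (\<exists>c\<in>P. x \<in> fst c \<and> y \<in> snd c))"
proof -
  \<comment> \<open>One open pair is chosen around each pair of network members admitting one, which
    keeps \<open>P\<close> no larger than \<open>\<N> \<times> \<N>\<close>.\<close>
  define R where "R = (\<lambda>m c. fst m \<subseteq> fst c \<and> snd m \<subseteq> snd c \<and>
    openin X (fst c) \<and> openin X (snd c) \<and> disjnt (fst c) (snd c))"
  define ch where "ch m = (SOME c. R m c)" for m
  define P where "P = ch ` {m \<in> \<N> \<times> \<N>. \<exists>c. R m c}"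
  have ch: "R m (ch m)" if "\<exists>c. R m c" for m
    unfolding ch_def using that by (rule someI_ex)
  have "|P| \<le>o |\<N> \<times> \<N>|"
    unfolding P_def by (rule ordLeq_transitive[OF card_of_image card_of_mono1]) auto
  moreover have "openin X (fst c) \<and> openin X (snd c) \<and> disjnt (fst c) (snd c)" if "c \<in> P" for c
    using that ch unfolding P_def R_def by blast
  moreover have "\<exists>c\<in>P. x \<in> fst c \<and> y \<in> snd c"
    if xy: "x \<in> topspace X" "y \<in> topspace X" "x \<noteq> y" for x y
  proof -
    obtain U V where UV: "openin X U" "openin X V" "x \<in> U" "y \<in> V" "disjnt U V"
      using X xy unfolding Hausdorff_space_def by blast
    obtain M where M: "M \<in> \<N>" "x \<in> M" "M \<subseteq> U"
      using \<N> UV unfolding is_network_def by blast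
    obtain N where N: "N \<in> \<N>" "y \<in> N" "N \<subseteq> V"
      using \<N> UV unfolding is_network_def by blast
    \<comment> \<open>\<open>(U, V)\<close> only shows that a choice for \<open>(M, N)\<close>
      exists. The chosen pair may differ, but it still contains \<open>M\<close> and
      \<open>N\<close> and hence separates the points.\<close>
    have "R (M, N) (U, V)"
      using UV M N unfolding R_def by simp
    then have "R (M, N) (ch (M, N))" "ch (M, N) \<in> P"
      using ch M N unfolding P_def by blast+
    with M N show ?thesis
      unfolding R_def by auto
  qed
  ultimately show ?thesis
    by (intro exI[of _ P] conjI[of "_ \<le>o _"] conjI[of "\<forall>c\<in>P. _ c"] ballI impI)
qed

lemma local_separation:
  assumes X: "tychonoff_space X" and \<F>: "nagami_family X \<F>" and x: "x \<in> topspace X"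
    and P: "\<And>c. c \<in> P \<Longrightarrow> openin X (fst c) \<and> openin X (snd c)"
    and sep: "\<And>x y. x \<in> topspace X \<Longrightarrow> y \<in> topspace X \<Longrightarrow> x \<noteq> y \<Longrightarrow> \<exists>c\<in>P. x \<in> fst c \<and> y \<in> snd c"
    and f: "continuous_map X euclideanreal f" and pq: "p < q"
  shows "\<exists>s\<in>Fpow \<F>. sc_embed X x \<in> \<Inter>s \<and> (\<exists>E\<in>Fpow (Fpow P).
    \<forall>z\<in>topspace X. sc_embed X z \<in> \<Inter>s \<longrightarrow>
      (f z \<le> p \<longrightarrow> z \<in> lower_comb E) \<and> (f z \<ge> q \<longrightarrow> z \<in> upper_comb E))"
proof -
  obtain K where K: "compactin X K"
    "\<forall>U. openin X U \<and> K \<subseteq> U \<longrightarrow>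
      (\<exists>s\<in>Fpow \<F>. sc_embed X x \<in> \<Inter>s \<and> {z\<in>topspace X. sc_embed X z \<in> \<Inter>s} \<subseteq> U)"
    using nagami_family_compact[OF X \<F> x] by (elim exE conjE)
  have pre_closed: "closedin X {z\<in>topspace X. f z \<in> S}" if "closed S" for S
    using closedin_continuous_map_preimage[OF f] that by simp
  have pre_open: "openin X {z\<in>topspace X. f z \<in> S}" if "open S" for S
    using openin_continuous_map_preimage[OF f] that by simp
  define A where "A = K \<inter> {z\<in>topspace X. f z \<in> {..p}}"
  define B where "B = K \<inter> {z\<in>topspace X. f z \<in> {q..}}"
  have "compactin X A" "compactin X B"
    unfolding A_def B_def by (intro compact_Int_closedin[OF K(1)] pre_closed closed_atMost closed_atLeast)+
  moreover have "\<exists>c\<in>P. a \<in> fst c \<and> b \<in> snd c" if "a \<in> A" "b \<in> B" for a b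
    using that pq by (intro sep) (auto simp: A_def B_def)
  ultimately obtain E where E: "E \<in> Fpow (Fpow P)" "A \<subseteq> lower_comb E" "B \<subseteq> upper_comb E"
    using compact_separation[of X A B P] P by blast
  \<comment> \<open>\<open>U\<close> is the set of points at which both required implications hold.
    It is open since their premises fail on open sets, and contains \<open>K\<close> since
    \<open>E\<close> separates \<open>A\<close> from \<open>B\<close>.\<close>
  define U where "U = ((topspace X \<inter> lower_comb E) \<union> {z\<in>topspace X. f z \<in> {p<..}}) \<inter>
    ((topspace X \<inter> upper_comb E) \<union> {z\<in>topspace X. f z \<in> {..<q}})"
  have "openin X U"
    unfolding U_def using P
    by (intro openin_Int openin_Un openin_Int_lower_comb[OF E(1)] openin_Int_upper_comb[OF E(1)] pre_open) auto
  moreover have "K \<subseteq> U"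
    using E(2,3) compactin_subset_topspace[OF K(1)] unfolding U_def A_def B_def by fastforce
  ultimately have "\<exists>s\<in>Fpow \<F>. sc_embed X x \<in> \<Inter>s \<and> {z\<in>topspace X. sc_embed X z \<in> \<Inter>s} \<subseteq> U"
    using K(2)[rule_format, of U] by simp
  then obtain s where s: "s \<in> Fpow \<F>" "sc_embed X x \<in> \<Inter>s"
    "{z\<in>topspace X. sc_embed X z \<in> \<Inter>s} \<subseteq> U"
    by blast
  have "(f z \<le> p \<longrightarrow> z \<in> lower_comb E) \<and> (f z \<ge> q \<longrightarrow> z \<in> upper_comb E)"
    if "z \<in> topspace X" "sc_embed X z \<in> \<Inter>s" for z
  proof -
    have "z \<in> U"
      using s(3) that by blast
    then show ?thesis
      unfolding U_def by auto
  qed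
  with s(1,2) E(1) show ?thesis
    by blast
qed

lemma Cfun_ordLeq_Func:
  assumes X: "tychonoff_space X" and \<N>: "is_network X \<N>" and \<F>: "nagami_family X \<F>"
    and B: "infinite B" "|\<N>| \<le>o |B|" and L: "infinite L" "|\<F>| \<le>o |L|"
  shows "|Cfun X| \<le>o |Func L B|"
proof -
  obtain P where P_card: "|P| \<le>o |\<N> \<times> \<N>|"
    and P': "\<forall>c\<in>P. openin X (fst c) \<and> openin X (snd c) \<and> disjnt (fst c) (snd c)"
    and sep': "\<forall>x\<in>topspace X. \<forall>y\<in>topspace X. x \<noteq> y \<longrightarrow> (\<exists>c\<in>P. x \<in> fst c \<and> y \<in> snd c)"
    using network_separating_pairs[OF tychonoff_imp_Hausdorff[OF X] \<N>] by (elim exE conjE)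
  note P = bspec[OF P'] and sep = sep'[rule_format]
  \<comment> \<open>\<open>D\<close> lists the questions put to \<open>f\<close>: two rational
    thresholds and a finite subfamily of \<open>\<F>\<close>. \<open>V\<close> holds the answers,
    with \<open>None\<close> when no combination fits.\<close>
  define D where "D = (UNIV :: (rat \<times> rat) set) \<times> Fpow \<F>"
  define V where "V = insert None (Some ` Fpow (Fpow P))"
  define ok where "ok f d E \<longleftrightarrow> E \<in> Fpow (Fpow P) \<and>
      (\<forall>z\<in>topspace X. sc_embed X z \<in> \<Inter>(snd d) \<longrightarrow>
        (f z \<le> of_rat (fst (fst d)) \<longrightarrow> z \<in> lower_comb E) \<and>
        (f z \<ge> of_rat (snd (fst d)) \<longrightarrow> z \<in> upper_comb E))"
    for f :: "'a \<Rightarrow> real" and d :: "(rat \<times> rat) \<times> (('a \<Rightarrow> real) \<Rightarrow> real) set set" and E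
  \<comment> \<open>The value \<open>undefined\<close> off \<open>D\<close> places the code in
    \<open>Func D V\<close>.\<close>
  define code where "code f = (\<lambda>d. if d \<in> D then
      (if \<exists>E. ok f d E then Some (SOME E. ok f d E) else None) else undefined)" for f
  \<comment> \<open>If \<open>f x < g x\<close>, take rationals \<open>p < q\<close> between. A
    combination answering for both functions would have \<open>x\<close> in both of its disjoint
    halves.\<close>
  have le: "g x \<le> f x"
    if f: "f \<in> Cfun X" and g: "g \<in> Cfun X" and eq: "code f = code g" and x: "x \<in> topspace X" for f g x
  proof (rule ccontr)
    assume "\<not> g x \<le> f x"
    then obtain p where p: "f x < of_rat p" "of_rat p < g x"
      using of_rat_dense[of "f x" "g x"] by auto
    then obtain q where q: "of_rat p < (of_rat q :: real)" "of_rat q < g x"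
      using of_rat_dense[of "of_rat p" "g x"] by auto
    have "continuous_map X euclideanreal f"
      using f by (simp add: Cfun_def)
    from local_separation[OF X \<F> x _ sep this q(1)] P
    obtain s E where s: "s \<in> Fpow \<F>" "sc_embed X x \<in> \<Inter>s" and E: "ok f ((p, q), s) E"
      unfolding ok_def by fastforce
    let ?d = "((p, q), s)"
    have d: "?d \<in> D"
      using s(1) by (simp add: D_def)
    define E' where "E' = (SOME E. ok f ?d E)"
    have okf: "ok f ?d E'"
      unfolding E'_def using E by (rule someI)
    have "code f ?d = Some E'"
      using d E unfolding code_def E'_def by auto
    then have "code g ?d = Some E'"
      unfolding eq .
    \<comment> \<open>An answer other than \<open>None\<close> certifies existence for
      \<open>g\<close> as well, and equal codes force the same chosen \<open>E'\<close>.\<close>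
    then have "\<exists>E. ok g ?d E" and "E' = (SOME E. ok g ?d E)"
      using d unfolding code_def by (auto split: if_splits)
    then have okg: "ok g ?d E'"
      using someI_ex by metis
    have "x \<in> lower_comb E'"
      using okf s(2) x p(1) unfolding ok_def by force
    moreover have "x \<in> upper_comb E'"
      using okg s(2) x q(2) unfolding ok_def by force
    moreover have "E' \<subseteq> Pow P"
      using okf unfolding ok_def Fpow_def by auto
    then have "disjnt (lower_comb E') (upper_comb E')"
      using P by (intro disjnt_lower_upper_comb) auto
    ultimately show False
      by (auto simp: disjnt_iff)
  qed
  have "inj_on code (Cfun X)"
  proof (rule inj_onI)
    fix f g assume fg: "f \<in> Cfun X" "g \<in> Cfun X" "code f = code g"
    show "f = g"
    proof (rule extensionalityI)
      show "f \<in> extensional (topspace X)" "g \<in> extensional (topspace X)"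
        using fg by (auto simp: Cfun_def)
      show "f x = g x" if "x \<in> topspace X" for x
        using le[OF fg that] le[OF fg(2,1) fg(3)[symmetric] that] by simp
    qed
  qed
  moreover have "code ` Cfun X \<subseteq> Func D V"
  proof -
    have "code f d \<in> V" if "d \<in> D" for f d
    proof (cases "\<exists>E. ok f d E")
      case True
      then have "ok f d (SOME E. ok f d E)"
        by (rule someI_ex)
      then have "(SOME E. ok f d E) \<in> Fpow (Fpow P)"
        unfolding ok_def[of f d] by (rule conjunct1)
      with True that show ?thesis
        unfolding code_def V_def by simp
    next
      case False
      show ?thesis
        unfolding code_def V_def if_P[OF that] if_not_P[OF False] by simp
    qed
    moreover have "code f d = undefined" if "d \<notin> D" for f d
      using that unfolding code_def by simp
    ultimately show ?thesis
      unfolding Func_def by blast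
  qed
  ultimately have "|Cfun X| \<le>o |Func D V|"
    using card_of_ordLeq by blast
  also have "|Func D V| \<le>o |Func L B|"
  proof (rule card_of_Func_mono)
    \<comment> \<open>The rational pairs are countable and \<open>Fpow\<close> does not exceed the
      infinite bound.\<close>
    show "|D| \<le>o |L|"
      unfolding D_def using L
      by (intro card_of_Times_ordLeq_infinite_Field)
         (auto simp: Field_card_of card_of_Card_order card_of_Fpow_ordLeq countable_ordLeq_infinite)
    have "|\<N> \<times> \<N>| \<le>o |B|"
      using B by (intro card_of_Times_ordLeq_infinite_Field) (auto simp: Field_card_of card_of_Card_order)
    then have "|P| \<le>o |B|"
      using P_card ordLeq_transitive by blast
    then show "|V| \<le>o |B|"
      unfolding V_def using B(1) by (intro card_of_option_ordLeq card_of_Fpow_ordLeq)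
    show "D \<noteq> {}"
      by (simp add: D_def Fpow_not_empty)
  qed
  finally show ?thesis .
qed

theorem theorem1:
  fixes X :: "'a topology"
  assumes "tychonoff_space X" and "topspace X \<noteq> {}"
  shows "(weight X, card_of (Cfun X)) \<in> ordLeq \<and>
         (card_of (Cfun X), BNF_Cardinal_Arithmetic.cexp (netweight X) (nagami X)) \<in> ordLeq"
proof
  show "weight X \<le>o |Cfun X|"
    using assms by (intro weight_ordLeq_Cfun) (auto simp: tychonoff_space_def)
  have "is_network X (Pow (topspace X))"
    unfolding is_network_def by (metis Pow_iff openin_subset order_refl)
  then have \<N>: "is_network X (min_card_set (is_network X))"
    by (rule min_card_set_minimal(1)[where P = "is_network X"])
  have \<F>: "nagami_family X (min_card_set (nagami_family X))"
    using nagami_family_exists[OF assms(1)] by (rule min_card_set_minimal(1)[where P = "nagami_family X"])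
  \<comment> \<open>The base and the exponent unfold to disjoint sums with the naturals. These are
    infinite and contain copies of the minimal network and the minimal Nagami family.\<close>
  show "|Cfun X| \<le>o netweight X ^c nagami X"
    unfolding netweight_def nagami_def inf_min_card_eq cexp_def Field_card_of
    by (rule Cfun_ordLeq_Func[OF assms(1) \<N> \<F>]) (auto simp: card_of_Plus1)
qed

end
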